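(* Let $S_0,S_1,\dots\in\mathbb{R}^{m\times n}$ be i.i.d. random embeddings satisfying the first and second inverse unbiased moments condition, with $m\ge m_0$ and corresponding constants $\theta_1,\theta_2>0$. Let $x_0$ be an initial point independent of the embeddings with $0<\mathbb{E}\{\delta_0\}<\infty$. Then the iterates $\{x_t\}$ of the flexible conjugate gradient method (FCG) with preconditioners $H_{S_t}$ and truncation parameters (nonnegative integers) satisfying $0<k_{t+1}\le k_t+1$ and $k_t\le t$ satisfy, at every iteration $t$, $$\frac{\mathbb{E}\{\delta_t\}}{\mathbb{E}\{\delta_0\}}\le\Big(1-\frac{\theta_1^2}{\theta_2}\Big)^t .$$
   Context: Let $n\ge d$, let $A\in\mathbb{R}^{n\times d}$ have full column rank, $b\in\mathbb{R}^d$, $H=A^\top A$, $f(x)=\frac12\langle x,Hx\rangle-\langle b,x\rangle$, $x^*=\mathrm{argmin}_x f(x)=H^{-1}b$, and $\delta_t=\frac12\langle x_t-x^*,H(x_t-x^* )\rangle$. For $S\in\mathbb{R}^{m\times n}$ set $H_S=A^\top S^\top SA$; $\dagger$ is the pseudo-inverse. It is assumed that the matrices $S_tA$ have full column rank almost surely. Inverse unbiased moments condition: a random embedding $S\in\mathbb{R}^{m\times n}$ (a family of distributions indexed by $m$) satisfies the condition if there exists $m_0\ge1$ such that for any $m\ge m_0$ there exist finite real numbers $\theta_1,\theta_2>0$ such that, for any $U\in\mathbb{R}^{n\times d}$ with orthonormal columns, $C_S=U^\top S^\top SU$ satisfies $\mathbb{E}\{C_S^{-1}\}=\theta_1 I_d$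 and $\mathbb{E}\{C_S^{-2}\}=\theta_2I_d$. FCG: at each iteration $t\geq 0$, with $v_t=H_{S_t}^\dagger\nabla f(x_t)$, set $$p_t=v_t-\sum_{j=t-k_t}^{t-1}\frac{\langle v_t,Hp_j\rangle}{\langle p_j,Hp_j\rangle}p_j,\qquad x_{t+1}=x_t+\frac{\langle p_t,\,b-Hx_t\rangle}{\langle p_t,Hp_t\rangle}p_t .$$ If $\nabla f(x_t)=0$ the method stops and $x_s:=x_t$ for $s\ge t$. *)

theory Defs
  imports "HOL-Probability.Probability"
begin

subsection \<open>The quadratic objective\<close>

definition hess :: "real^'d^'n \<Rightarrow> real^'d^'d" where
  "hess A = transpose A ** A"

definition quad :: "real^'d^'n \<Rightarrow> real^'d \<Rightarrow> real^'d \<Rightarrow> real" where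
  "quad A b x = inner x (hess A *v x) / 2 - inner b x"

definition grad :: "('a::real_inner \<Rightarrow> real) \<Rightarrow> 'a \<Rightarrow> 'a" where
  "grad F x = (THE g. GDERIV F x :> g)"

definition xstar :: "real^'d^'n \<Rightarrow> real^'d \<Rightarrow> real^'d" where
  "xstar A b = (ARG_MIN (quad A b) x. True)"

definition subopt :: "real^'d^'n \<Rightarrow> real^'d \<Rightarrow> real^'d \<Rightarrow> real" where
  "subopt A b x = inner (x - xstar A b) (hess A *v (x - xstar A b)) / 2"

definition moore_penrose :: "real^'c^'r \<Rightarrow> real^'r^'c \<Rightarrow> bool" where
  "moore_penrose M P \<longleftrightarrow>
     M ** P ** M = M \<and> P ** M ** P = P \<and>
     transpose (M ** P) = M ** P \<and> transpose (P ** M) = P ** M"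

definition pinv :: "real^'c^'r \<Rightarrow> real^'r^'c" where
  "pinv M = (THE P. moore_penrose M P)"

subsection \<open>Random embeddings\<close>

text \<open>
  The inverse moment condition ranges over all sufficiently large row numbers \<open>m\<close>, so \<open>m\<close> cannot
  be a type.  An \<open>m \<times> n\<close> matrix \<open>S\<close> is therefore the function mapping \<open>r < m\<close> to its \<open>r\<close>-th row,
  a vector in \<open>real^'n\<close>.  The product \<open>\<sigma>\<close>-algebra below is the Borel \<open>\<sigma>\<close>-algebra of the space of
  these matrices.
\<close>

type_synonym 'n sketch = "nat \<Rightarrow> real^'n"

definition sketch_space :: "nat \<Rightarrow> ('n::finite) sketch measure" where
  "sketch_space m = PiM {..<m} (\<lambda>_. borel)"

text \<open>\<open>S\<^sup>T S\<close>, entrywise.\<close>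

definition sketch_gram :: "nat \<Rightarrow> ('n::finite) sketch \<Rightarrow> real^'n^'n" where
  "sketch_gram m S = (\<chi> i j. \<Sum>r<m. S r $ i * S r $ j)"

text \<open>\<open>B\<^sup>T S\<^sup>T S B\<close>: this is \<open>H\<^sub>S\<close> for \<open>B = A\<close> and \<open>C\<^sub>S\<close> for \<open>B = U\<close>.\<close>

definition sketched :: "nat \<Rightarrow> ('n::finite) sketch \<Rightarrow> real^'d^'n \<Rightarrow> real^'d^'d" where
  "sketched m S B = transpose B ** sketch_gram m S ** B"

text \<open>The rows of \<open>S B\<close> are the vectors \<open>S r v* B\<close>; compare \<open>row_rank_def\<close>.\<close>

definition full_column_rank_sketch :: "nat \<Rightarrow> ('n::finite) sketch \<Rightarrow> real^'d^'n \<Rightarrow> bool" where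
  "full_column_rank_sketch m S B \<longleftrightarrow> dim ((\<lambda>r. S r v* B) ` {..<m}) = CARD('d)"

definition embedding_family :: "(nat \<Rightarrow> ('n::finite) sketch measure) \<Rightarrow> bool" where
  "embedding_family D \<longleftrightarrow>
     (\<forall>m\<ge>1. prob_space (D m) \<and> sets (D m) = sets (sketch_space m))"

text \<open>
  The expectations of \<open>C\<^sub>S\<^sup>-\<^sup>1\<close> and \<open>C\<^sub>S\<^sup>-\<^sup>2\<close> presuppose that \<open>C\<^sub>S\<close> is almost surely invertible and that
  they exist, which \<open>has_bochner_integral\<close> includes.  The first argument only fixes the number
  \<open>CARD('d)\<close> of columns of \<open>U\<close>.
\<close>

definition inverse_moments ::
  "('d::finite) itself \<Rightarrow> nat \<Rightarrow> ('n::finite) sketch measure \<Rightarrow> real \<Rightarrow> real \<Rightarrow> bool" where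
  "inverse_moments _ m \<mu> \<theta>1 \<theta>2 \<longleftrightarrow>
     (\<forall>U :: real^'d^'n. transpose U ** U = mat 1 \<longrightarrow>
        (AE S in \<mu>. invertible (sketched m S U)) \<and>
        has_bochner_integral \<mu> (\<lambda>S. matrix_inv (sketched m S U)) (\<theta>1 *\<^sub>R mat 1) \<and>
        has_bochner_integral \<mu>
          (\<lambda>S. matrix_inv (sketched m S U) ** matrix_inv (sketched m S U)) (\<theta>2 *\<^sub>R mat 1))"

definition inverse_unbiased_moments ::
  "('d::finite) itself \<Rightarrow> (nat \<Rightarrow> ('n::finite) sketch measure) \<Rightarrow> nat \<Rightarrow> bool" where
  "inverse_unbiased_moments d D m0 \<longleftrightarrow>
     m0 \<ge> 1 \<and>
     (\<forall>m\<ge>m0. \<exists>\<theta>1 \<theta>2. \<theta>1 > 0 \<and> \<theta>2 > 0 \<and> inverse_moments d m (D m) \<theta>1 \<theta>2)"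

text \<open>
  \<open>prob_space.indep_var\<close> forces both random variables to have the same value type; this is its
  characterisation by generated \<open>\<sigma>\<close>-algebras (\<open>indep_var_eq\<close>) without that restriction.
\<close>

definition indep_rv ::
  "'w measure \<Rightarrow> 'a measure \<Rightarrow> ('w \<Rightarrow> 'a) \<Rightarrow> 'b measure \<Rightarrow> ('w \<Rightarrow> 'b) \<Rightarrow> bool" where
  "indep_rv M MX X MY Y \<longleftrightarrow>
     X \<in> measurable M MX \<and> Y \<in> measurable M MY \<and>
     prob_space.indep_set M
       (sets (vimage_algebra (space M) X MX)) (sets (vimage_algebra (space M) Y MY))"

subsection \<open>The flexible conjugate gradient method\<close>

definition precond_grad ::
  "real^'d^'n \<Rightarrow> real^'d \<Rightarrow> nat \<Rightarrow> ('n::finite) sketch \<Rightarrow> real^'d \<Rightarrow> real^'d" where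
  "precond_grad A b m S x = pinv (sketched m S A) *v grad (quad A b) x"

text \<open>
  \<open>fcg_x \<dots> t\<close> is \<open>x\<^sub>t\<close> and \<open>fcg_p \<dots> t\<close> is \<open>p\<^sub>t\<close>.  The directions are also defined after the method has
  stopped, but are then not used by the iterates.  The lower summation bound \<open>t - k t\<close> is
  a truncated subtraction, harmless for \<open>k t \<le> t\<close>.
\<close>

function (sequential)
  fcg_x :: "real^'d^'n \<Rightarrow> real^'d \<Rightarrow> nat \<Rightarrow> (nat \<Rightarrow> nat) \<Rightarrow> (nat \<Rightarrow> ('n::finite) sketch) \<Rightarrow>
    real^'d \<Rightarrow> nat \<Rightarrow> real^'d" and
  fcg_p :: "real^'d^'n \<Rightarrow> real^'d \<Rightarrow> nat \<Rightarrow> (nat \<Rightarrow> nat) \<Rightarrow> (nat \<Rightarrow> ('n::finite) sketch) \<Rightarrow>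
    real^'d \<Rightarrow> nat \<Rightarrow> real^'d"
where
  "fcg_x A b m k S x0 0 = x0"
| "fcg_x A b m k S x0 (Suc t) =
     (let x = fcg_x A b m k S x0 t; p = fcg_p A b m k S x0 t in
      if grad (quad A b) x = 0 then x
      else x + (inner p (b - hess A *v x) / inner p (hess A *v p)) *\<^sub>R p)"
| "fcg_p A b m k S x0 t =
     (let v = precond_grad A b m (S t) (fcg_x A b m k S x0 t) in
      v - (\<Sum>j = t - k t..<t.
             (inner v (hess A *v fcg_p A b m k S x0 j) /
              inner (fcg_p A b m k S x0 j) (hess A *v fcg_p A b m k S x0 j))
             *\<^sub>R fcg_p A b m k S x0 j))"
  by pat_completeness auto
termination
  by (relation "Wellfounded.measure (case_sum (\<lambda>(_,_,_,_,_,_,t). 2 * t) (\<lambda>(_,_,_,_,_,_,t). 2 * t + 1))") auto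

declare fcg_p.simps [simp del]

definition fcg_err ::
  "real^'d^'n \<Rightarrow> real^'d \<Rightarrow> nat \<Rightarrow> (nat \<Rightarrow> nat) \<Rightarrow> (nat \<Rightarrow> ('n::finite) sketch) \<Rightarrow>
    real^'d \<Rightarrow> nat \<Rightarrow> real" where
  "fcg_err A b m k S x0 t = subopt A b (fcg_x A b m k S x0 t)"

subsection \<open>Gradient, minimizer and pseudo-inverse in closed form\<close>

lemma matrix_inv_mult:
  assumes "invertible M"
  shows "M ** matrix_inv M = mat 1" and "matrix_inv M ** M = mat 1"
  using someI_ex[OF assms[unfolded invertible_def]] by (simp_all add: matrix_inv_def)

lemma pinv_invertible:
  fixes M :: "real^'c^'c"
  assumes "invertible M"
  shows "pinv M = matrix_inv M"
  unfolding pinv_def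
proof (rule the_equality)
  show "moore_penrose M (matrix_inv M)"
    by (simp add: moore_penrose_def matrix_inv_mult[OF assms] transpose_mat)
next
  fix P assume "moore_penrose M P"
  then have MPM: "M ** P ** M = M"
    by (simp add: moore_penrose_def)
  have "P = (matrix_inv M ** M) ** P ** (M ** matrix_inv M)"
    by (simp add: matrix_inv_mult[OF assms])
  also have "\<dots> = matrix_inv M ** (M ** P ** M) ** matrix_inv M"
    by (simp only: matrix_mul_assoc)
  also have "\<dots> = matrix_inv M"
    by (simp add: MPM matrix_inv_mult[OF assms])
  finally show "P = matrix_inv M" .
qed

lemma inner_hess: "inner x (hess A *v y) = inner (A *v x) (A *v y)"
  unfolding hess_def
  by (metis dot_lmul_matrix inner_commute matrix_vector_mul_assoc transpose_matrix_vector)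

lemma gderiv_quad: "GDERIV (quad A b) x :> hess A *v x - b"
proof -
  have sym: "inner x (hess A *v h) = inner h (hess A *v x)" for h
    by (simp add: inner_hess inner_commute)
  have "((\<lambda>x. inner x (hess A *v x) / 2 - inner b x) has_derivative
      (\<lambda>h. (inner x (hess A *v h) + inner h (hess A *v x)) / 2 - inner b h)) (at x)"
    by (rule derivative_eq_intros refl has_derivative_const
        bounded_linear.has_derivative[OF matrix_vector_mul_bounded_linear]
        | simp)+
  then show ?thesis
    unfolding gderiv_def quad_def[abs_def]
    by (simp add: sym inner_diff_right inner_commute)
qed

lemma grad_eqI:
  assumes "GDERIV F x :> g"
  shows "grad F x = g"
  unfolding grad_def
proof (rule the_equality)
  show "GDERIV F x :> g" by (rule assms)
next
  fix g' assume "GDERIV F x :> g'"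
  with assms have "(\<lambda>h. inner h g') = (\<lambda>h. inner h g)"
    unfolding gderiv_def by (rule has_derivative_unique[rotated])
  then have "inner h (g' - g) = 0" for h
    by (simp add: inner_diff_right fun_eq_iff)
  then have "inner (g' - g) (g' - g) = 0" .
  then show "g' = g" by simp
qed

lemma grad_quad: "grad (quad A b) x = hess A *v x - b"
  by (rule grad_eqI[OF gderiv_quad])

lemma xstar_eq:
  fixes A :: "real^'d^'n"
  assumes "rank A = CARD('d)"
  shows "invertible (hess A)" and "xstar A b = matrix_inv (hess A) *v b"
proof -
  have inj: "A *v x = 0 \<Longrightarrow> x = 0" for x
    using assms by (metis full_rank_injective injD matrix_vector_mult_0_right)
  have "hess A *v x = 0 \<Longrightarrow> x = 0" for x
    using inj[of x] inner_hess[of x A x] by simp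
  then show inv: "invertible (hess A)"
    using matrix_left_invertible_ker[of "hess A"] by (auto simp: invertible_left_inverse)
  define z where "z = matrix_inv (hess A) *v b"
  have Hz: "hess A *v z = b"
    by (simp add: z_def matrix_vector_mul_assoc matrix_inv_mult[OF inv])
  have gap: "quad A b y = quad A b z + inner (A *v (y - z)) (A *v (y - z)) / 2" for y
  proof -
    have b: "inner b w = inner (A *v z) (A *v w)" for w
      by (metis Hz inner_commute inner_hess)
    show ?thesis
      by (simp add: quad_def inner_hess b matrix_vector_mult_diff_distrib
            inner_diff_left inner_diff_right inner_commute field_simps)
  qed
  have "quad A b z \<le> quad A b y" for y
    using gap[of y] by simp
  then have z: "is_arg_min (quad A b) (\<lambda>_. True) z"
    unfolding is_arg_min_linorder by blast
  have "is_arg_min (quad A b) (\<lambda>_. True) (xstar A b)"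
    unfolding xstar_def arg_min_def by (rule someI[of "is_arg_min (quad A b) (\<lambda>_. True)", OF z])
  then have "quad A b (xstar A b) \<le> quad A b z"
    unfolding is_arg_min_linorder by simp
  then have "inner (A *v (xstar A b - z)) (A *v (xstar A b - z)) \<le> 0"
    using gap[of "xstar A b"] by simp
  then have "A *v (xstar A b - z) = 0"
    by (simp add: order_antisym_conv[OF inner_ge_zero])
  then show "xstar A b = matrix_inv (hess A) *v b"
    using inj[of "xstar A b - z"] by (simp add: z_def)
qed

end

theory Submission
  imports Defs
begin

text \<open>
  Write \<open>A = U R\<close> with orthonormal \<open>U\<close> and invertible \<open>R\<close>, put \<open>w\<^sub>t = R (x\<^sub>t - x*)\<close>, so that
  \<open>\<delta>\<^sub>t = \<parallel>w\<^sub>t\<parallel>\<^sup>2 / 2\<close>, and let \<open>J\<^sub>t\<close> be the inverse of \<open>U\<^sup>T S\<^sub>t\<^sup>T S\<^sub>t U\<close>.  Since the truncation windows can only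
  lose their oldest directions, the error \<open>x\<^sub>t\<^sub>+\<^sub>1 - x*\<close> is \<open>H\<close>-orthogonal to all the directions of which
  \<open>v\<^sub>t\<close> is a combination.  Hence a flexible CG step is at least as good as the plain preconditioned step
  \<open>x\<^sub>t - c v\<^sub>t\<close> for every constant \<open>c\<close>, and
  \<open>2 \<delta>\<^sub>t\<^sub>+\<^sub>1 \<le> \<parallel>w\<^sub>t - c J\<^sub>t w\<^sub>t\<parallel>\<^sup>2 = \<parallel>w\<^sub>t\<parallel>\<^sup>2 - 2 c w\<^sub>t\<^sup>T J\<^sub>t w\<^sub>t + c\<^sup>2 w\<^sub>t\<^sup>T J\<^sub>t\<^sup>2 w\<^sub>t\<close>.
  The right-hand side is linear in \<open>J\<^sub>t\<close> and \<open>J\<^sub>t\<^sup>2\<close>, which are independent of \<open>w\<^sub>t\<close>, so its expectation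
  is \<open>2 (1 - 2 c \<theta>\<^sub>1 + c\<^sup>2 \<theta>\<^sub>2) E \<delta>\<^sub>t\<close>; the best choice is \<open>c = \<theta>\<^sub>1 / \<theta>\<^sub>2\<close>.
\<close>

subsection \<open>Descent of flexible CG steps\<close>

text \<open>
  Directions \<open>P j = 0\<close> are allowed, as then the quotients are \<open>0 / 0 = 0\<close>; in particular the recursion for
  \<open>E\<close> also covers the iterations after the method has stopped.
\<close>

lemma truncated_conjugate_descent:
  fixes E V P :: "nat \<Rightarrow> 'a::real_inner"
  assumes P: "\<And>t. P t = V t - (\<Sum>j = t - k t..<t. (inner (V t) (P j) / inner (P j) (P j)) *\<^sub>R P j)"
    and E: "\<And>t. E (Suc t) = E t - (inner (P t) (E t) / inner (P t) (P t)) *\<^sub>R P t"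
    and k: "\<And>t. k (Suc t) \<le> k t + 1"
  shows "norm (E (Suc t)) \<le> norm (E t + c *\<^sub>R V t)"
proof -
  \<comment> \<open>Window starts never move backwards, so a direction that has left the window does
    not return. This is where the bound on \<open>k\<close> enters.\<close>
  have mono: "i - k i \<le> j - k j" if "i \<le> j" for i j
    using that
  proof (induction rule: dec_induct)
    case (step n)
    with k[of n] show ?case by linarith
  qed simp
  have PP: "inner (P i) (P j) = 0" if "j - k j \<le> i" "i < j" for i j
    using that
  proof (induction j arbitrary: i rule: less_induct)
    case (less j)
    let ?c = "\<lambda>l. inner (V j) (P l) / inner (P l) (P l)"
    have "inner (P i) (P l) = 0" if "l \<in> {j - k j..<j} - {i}" for l
    proof (cases i l rule: linorder_cases)
      case less
      with that mono[of l j] less.prems show ?thesis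
        by (intro less.IH) auto
    next
      case greater
      with that mono[of i j] less.prems have "inner (P l) (P i) = 0"
        by (intro less.IH) auto
      then show ?thesis by (simp add: inner_commute)
    qed (use that in auto)
    \<comment> \<open>Only the term \<open>l = i\<close> survives. It equals
      \<open>inner (V j) (P i)\<close>, also when \<open>P i = 0\<close>, and subtracting it is what
      makes \<open>P j\<close> orthogonal to \<open>P i\<close>.\<close>
    then have "inner (P i) (\<Sum>l = j - k j..<j. ?c l *\<^sub>R P l) = ?c i * inner (P i) (P i)"
      using less.prems
      by (subst sum.remove[of _ i]) (auto simp: inner_add_right inner_sum_right)
    then show ?case
      by (subst P) (simp add: inner_diff_right inner_commute)
  qed
  have step: "inner (P t) (E (Suc t)) = 0" for t
    by (simp add: E inner_diff_right)
  have PE: "inner (P j) (E t) = 0" if "t - k t \<le> j" "j < t" for j t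
    using that
  proof (induction t)
    case (Suc t)
    show ?case
    proof (cases "j = t")
      case False
      with Suc.prems mono[of t "Suc t"] have "t - k t \<le> j" "j < t" by auto
      with Suc.IH PP[of t j] show ?thesis
        by (simp add: E inner_diff_right)
    qed (simp add: step)
  qed simp
  define Z where "Z = E t + c *\<^sub>R V t - E (Suc t)"
  \<comment> \<open>\<open>PE\<close> at \<open>Suc t\<close> covers only the window of
    \<open>Suc t\<close>, which may be missing old directions, whereas \<open>V t\<close> is
    expanded over the window of \<open>t\<close>.\<close>
  have PE': "inner (P j) (E (Suc t)) = 0" if "t - k t \<le> j" "j < t" for j
    using that PE[of t j] PP[of t j] by (simp add: E inner_diff_right)
  have V: "V t = P t + (\<Sum>j = t - k t..<t. (inner (V t) (P j) / inner (P j) (P j)) *\<^sub>R P j)"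
    by (subst P) simp
  have "inner (V t) (E (Suc t)) = 0"
    by (subst V) (auto simp: inner_add_left inner_sum_left step PE')
  \<comment> \<open>\<open>Z\<close> combines \<open>P t\<close> and \<open>V t\<close>, both
    orthogonal to \<open>E (Suc t)\<close>; by Pythagoras adding \<open>Z\<close> cannot shorten the
    error.\<close>
  then have "inner (E (Suc t)) Z = 0"
    using step[of t] by (simp add: Z_def E inner_add_right inner_diff_right inner_commute
        inner_add_left inner_diff_left)
  then have "(norm (E (Suc t) + Z))\<^sup>2 = (norm (E (Suc t)))\<^sup>2 + (norm Z)\<^sup>2"
    by (simp add: power2_norm_eq_inner inner_add_left inner_add_right inner_commute)
  then have "(norm (E (Suc t)))\<^sup>2 \<le> (norm (E (Suc t) + Z))\<^sup>2"
    by simp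
  then have "norm (E (Suc t)) \<le> norm (E (Suc t) + Z)"
    by (rule power2_le_imp_le) simp
  then show ?thesis
    by (simp add: Z_def)
qed

lemma subopt_eq_norm: "subopt A b x = (norm (A *v (x - xstar A b)))\<^sup>2 / 2"
  by (simp add: subopt_def inner_hess power2_norm_eq_inner)

text \<open>Applying \<open>A\<close> turns the \<open>hess A\<close>-inner product into the
  standard one, so the images under \<open>A\<close> of errors, preconditioned gradients and
  directions obey the recursions of \<open>truncated_conjugate_descent\<close>.\<close>

lemma fcg_subopt_descent:
  fixes A :: "real^'d^'n"
  assumes A: "rank A = CARD('d)" and k: "\<And>t. k (Suc t) \<le> k t + 1"
  shows "subopt A b (fcg_x A b m k S x0 (Suc t)) \<le>
    subopt A b (fcg_x A b m k S x0 t
      + c *\<^sub>R precond_grad A b m (S t) (fcg_x A b m k S x0 t))"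
proof -
  let ?x = "fcg_x A b m k S x0" and ?p = "fcg_p A b m k S x0"
  let ?z = "xstar A b"
  let ?E = "\<lambda>t. A *v (?x t - ?z)"
  let ?V = "\<lambda>t. A *v precond_grad A b m (S t) (?x t)"
  let ?P = "\<lambda>t. A *v ?p t"
  have Hz: "hess A *v ?z = b"
    by (simp add: xstar_eq[OF A] matrix_vector_mul_assoc matrix_inv_mult)
  have r: "b - hess A *v x = - (hess A *v (x - ?z))" for x
    by (simp add: matrix_vector_mult_diff_distrib Hz)
  have P: "?P t = ?V t - (\<Sum>j = t - k t..<t. (inner (?V t) (?P j) / inner (?P j) (?P j)) *\<^sub>R ?P j)" for t
    by (subst fcg_p.simps)
      (simp add: Let_def matrix_vector_mult_diff_distrib inner_hess matrix_vector_mult_scaleR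
        linear_sum[OF matrix_vector_mul_linear])
  have E: "?E (Suc t) = ?E t - (inner (?P t) (?E t) / inner (?P t) (?P t)) *\<^sub>R ?P t" for t
  proof (cases "grad (quad A b) (?x t) = 0")
    \<comment> \<open>After stopping, the image of the error under \<open>A\<close> is 0, so the
      correction term vanishes and the recursion holds with \<open>?x\<close> unchanged.\<close>
    case True
    then have "hess A *v (?x t - ?z) = 0"
      by (simp add: grad_quad matrix_vector_mult_diff_distrib Hz)
    then have "?E t = 0"
      by (metis inner_eq_zero_iff inner_hess inner_zero_right)
    with True show ?thesis by (simp add: Let_def)
  next
    case False
    then have "?x (Suc t) - ?z
        = (?x t - ?z) - (inner (?P t) (?E t) / inner (?P t) (?P t)) *\<^sub>R ?p t"
      by (simp add: Let_def r inner_hess)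
    then show ?thesis
      by (simp only: matrix_vector_mult_diff_distrib matrix_vector_mult_scaleR)
  qed
  have "norm (?E (Suc t)) \<le> norm (?E t + c *\<^sub>R ?V t)"
    by (rule truncated_conjugate_descent[OF P E k])
  also have "?E t + c *\<^sub>R ?V t
      = A *v (?x t + c *\<^sub>R precond_grad A b m (S t) (?x t) - ?z)"
    by (simp add: matrix_vector_right_distrib matrix_vector_mult_diff_distrib
        matrix_vector_mult_scaleR)
  finally have "(norm (?E (Suc t)))\<^sup>2
      \<le> (norm (A *v (?x t + c *\<^sub>R precond_grad A b m (S t) (?x t) - ?z)))\<^sup>2"
    by (rule power_mono) simp
  then show ?thesis
    by (simp only: subopt_eq_norm divide_right_mono)
qed

section \<open>Orthonormal coordinates and the plain preconditioned step\<close>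

text \<open>The moment condition speaks of orthonormal columns; this factorization makes it
  applicable to \<open>A\<close>. By full rank there is an isometry \<open>U\<close> onto the range
  of \<open>A\<close>, and \<open>R\<close> is \<open>A\<close> followed by the inverse
  isometry.\<close>

lemma orthonormal_factorization:
  fixes A :: "real^'d^'n"
  assumes A: "rank A = CARD('d)"
  obtains U :: "real^'d^'n" and R :: "real^'d^'d"
  where "transpose U ** U = mat 1" "A = U ** R" "invertible R"
proof -
  have sub: "subspace (range ((*v) A))"
    by (intro linear_subspace_image matrix_vector_mul_linear subspace_UNIV)
  have dim: "dim (UNIV :: (real^'d) set) = dim (range ((*v) A))"
    using A by (simp add: rank_dim_range)
  obtain f :: "real^'d \<Rightarrow> real^'n" and g
    where f: "linear f" and g: "linear g"
      and nf: "\<And>x. norm (f x) = norm x"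
      and fg: "\<And>x. x \<in> range ((*v) A) \<Longrightarrow> f (g x) = x"
    using isometries_subspaces[OF subspace_UNIV sub dim] by (metis UNIV_I)
  define U where "U = matrix f"
  define R where "R = matrix (\<lambda>x. g (A *v x))"
  have U: "U *v x = f x" for x
    by (simp add: U_def matrix_works f)
  have R: "R *v x = g (A *v x)" for x
    using linear_compose[OF matrix_vector_mul_linear g, of A] by (simp add: R_def o_def)
  have fdot: "inner (f x) (f y) = inner x y" for x y
    using f nf by (simp add: dot_norm linear_add[OF f, symmetric])
  have "inner x ((transpose U ** U) *v y) = inner x y" for x y
    using fdot[of x y] by (simp add: U[symmetric] hess_def[symmetric] inner_hess)
  then have "transpose U ** U = mat 1"
    by (metis inner_commute matrix_eq matrix_vector_mul_lid vector_eq_ldot)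
  moreover have A_eq: "A = U ** R"
    by (simp add: matrix_eq matrix_vector_mul_assoc[symmetric] U R fg)
  moreover have "R *v x = 0 \<Longrightarrow> x = 0" for x
    using A A_eq by (metis full_rank_injective injD matrix_vector_mul_assoc matrix_vector_mult_0_right)
  then have "invertible R"
    by (auto simp: invertible_left_inverse matrix_left_invertible_ker)
  ultimately show thesis
    by (rule that)
qed

lemma inner_orthonormal:
  fixes U :: "real^'d^'n"
  assumes "transpose U ** U = mat 1"
  shows "inner (U *v x) (U *v y) = inner x y"
  using inner_hess[of x U y] assms by (simp add: hess_def)

lemma sketched_mult: "sketched m S (U ** R) = transpose R ** sketched m S U ** R"
  by (simp add: sketched_def matrix_transpose_mul matrix_mul_assoc)

lemma transpose_sketched: "transpose (sketched m S B) = sketched m S B"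
proof -
  have "transpose (sketch_gram m S) = sketch_gram m S"
    by (simp add: transpose_def sketch_gram_def vec_eq_iff mult.commute)
  then show ?thesis
    by (simp add: sketched_def matrix_transpose_mul matrix_mul_assoc)
qed

text \<open>Since \<open>hess A = transpose R ** R\<close> and
  \<open>sketched m S A = transpose R ** sketched m S U ** R\<close>, the factors of
  \<open>R\<close> cancel in the coordinates \<open>w\<close>: the preconditioned gradient becomes
  \<open>J *v w\<close>, and the step leads from \<open>w\<close> to
  \<open>w + c *\<^sub>R (J *v w)\<close>.\<close>

lemma subopt_preconditioned_step:
  fixes A U :: "real^'d^'n" and R :: "real^'d^'d"
    and b x :: "real^'d"
  assumes A: "rank A = CARD('d)" "A = U ** R"
    and U: "transpose U ** U = mat 1" and R: "invertible R"
    and C: "invertible (sketched m S U)"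
  defines "J \<equiv> matrix_inv (sketched m S U)" and "w \<equiv> R *v (x - xstar A b)"
  shows "subopt A b (x + c *\<^sub>R precond_grad A b m S x) =
    ((norm w)\<^sup>2 + 2 * c * inner w (J *v w) + c\<^sup>2 * inner w ((J ** J) *v w)) / 2"
proof -
  let ?C = "sketched m S U" and ?HS = "sketched m S A"
  define v where "v = precond_grad A b m S x"
  have Rt: "invertible (transpose R)"
    using R by (rule transpose_invertible)
  have HS: "?HS = transpose R ** ?C ** R"
    by (simp add: A(2) sketched_mult)
  have inv: "invertible ?HS"
    unfolding HS by (intro invertible_mult Rt C R)
  have H: "hess A = transpose R ** R"
    by (simp add: hess_def A(2) matrix_transpose_mul matrix_mul_assoc)
      (simp add: matrix_mul_assoc[symmetric, of _ _ U] matrix_mul_assoc[symmetric, of "transpose R"] U)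
  have Hz: "hess A *v xstar A b = b"
    by (simp add: xstar_eq[OF A(1)] matrix_vector_mul_assoc matrix_inv_mult)
  have "grad (quad A b) x = hess A *v (x - xstar A b)"
    by (simp add: grad_quad matrix_vector_mult_diff_distrib Hz)
  also have "\<dots> = transpose R *v w"
    by (simp only: H w_def matrix_vector_mul_assoc)
  finally have g: "grad (quad A b) x = transpose R *v w" .
  have "?HS *v v = transpose R *v w"
    by (simp add: v_def precond_grad_def pinv_invertible[OF inv] matrix_vector_mul_assoc
        matrix_mul_assoc matrix_inv_mult[OF inv] g del: transpose_matrix_vector)
  then have "transpose R *v (?C *v (R *v v)) = transpose R *v w"
    by (simp only: HS matrix_vector_mul_assoc matrix_mul_assoc)
  then have "matrix_inv (transpose R) *v (transpose R *v (?C *v (R *v v)))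
      = matrix_inv (transpose R) *v (transpose R *v w)"
    by simp
  then have "?C *v (R *v v) = w"
    by (simp only: matrix_vector_mul_assoc[of "matrix_inv (transpose R)"] matrix_inv_mult[OF Rt] matrix_vector_mul_lid)
  then have Rv: "R *v v = J *v w"
    by (metis C J_def matrix_inv_mult(2) matrix_vector_mul_assoc matrix_vector_mul_lid)
  have "A *v (x + c *\<^sub>R v - xstar A b) = U *v (R *v (x - xstar A b + c *\<^sub>R v))"
    by (simp add: A(2) matrix_vector_mul_assoc algebra_simps)
  also have "R *v (x - xstar A b + c *\<^sub>R v) = w + c *\<^sub>R (J *v w)"
    by (simp only: matrix_vector_right_distrib matrix_vector_mult_scaleR Rv w_def)
  finally have "subopt A b (x + c *\<^sub>R v) = inner (w + c *\<^sub>R (J *v w)) (w + c *\<^sub>R (J *v w)) / 2"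
    by (simp only: subopt_eq_norm power2_norm_eq_inner inner_orthonormal[OF U])
  \<comment> \<open>\<open>J\<close> inherits symmetry from \<open>?C\<close>: insert
    \<open>?C ** J = mat 1\<close> in one argument and move \<open>?C\<close> to the other.\<close>
  moreover have "inner (J *v w) (J *v w) = inner w ((J ** J) *v w)"
  proof -
    have w: "w = ?C *v (J *v w)" for w
      by (simp add: J_def matrix_vector_mul_assoc matrix_inv_mult[OF C])
    have sym: "inner (?C *v y) z = inner y (?C *v z)" for y z
      by (metis dot_lmul_matrix transpose_matrix_vector transpose_sketched)
    have "inner (J *v w) (J *v w) = inner (J *v w) (?C *v (J *v (J *v w)))"
      by (subst (2) w) (rule refl)
    also have "\<dots> = inner w (J *v (J *v w))"
      by (subst sym[symmetric]) (simp only: w[symmetric])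
    finally show ?thesis
      by (simp only: matrix_vector_mul_assoc)
  qed
  ultimately show ?thesis
    by (simp add: v_def inner_add_left inner_add_right inner_commute power2_norm_eq_inner[of w]
        power2_eq_square[of c] algebra_simps)
qed

subsection \<open>Measurability of the iterates\<close>

text \<open>\<open>M ** P\<close> and \<open>M ** Q\<close> are symmetric, so transposing
  \<open>M ** P = (M ** Q) ** (M ** P)\<close> swaps the factors and yields \<open>M ** Q\<close>.
  Likewise \<open>P ** M = Q ** M\<close>, and then \<open>P ** M ** P\<close> turns into
  \<open>Q ** M ** Q\<close>.\<close>

lemma moore_penrose_unique:
  assumes "moore_penrose M P" "moore_penrose M Q"
  shows "P = Q"
proof -
  note P = assms(1)[unfolded moore_penrose_def] and Q = assms(2)[unfolded moore_penrose_def]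
  have "M ** P = transpose (M ** Q ** M ** P)"
    using P Q by metis
  also have "\<dots> = transpose ((M ** Q) ** (M ** P))"
    by (simp only: matrix_mul_assoc)
  also have "\<dots> = (M ** P) ** (M ** Q)"
    using P Q by (metis matrix_transpose_mul)
  also have "\<dots> = M ** Q"
    using P by (simp add: matrix_mul_assoc)
  finally have MP: "M ** P = M ** Q" .
  have "P ** M = transpose (P ** (M ** Q ** M))"
    using P Q by metis
  also have "\<dots> = transpose ((P ** M) ** (Q ** M))"
    by (simp only: matrix_mul_assoc)
  also have "\<dots> = (Q ** M) ** (P ** M)"
    using P Q by (metis matrix_transpose_mul)
  also have "\<dots> = Q ** (M ** P ** M)"
    by (simp only: matrix_mul_assoc)
  also have "\<dots> = Q ** M"
    using P by simp
  finally have PM: "P ** M = Q ** M" .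
  have "P = P ** (M ** P)"
    using P by (simp add: matrix_mul_assoc)
  also have "\<dots> = (P ** M) ** Q"
    by (simp add: MP matrix_mul_assoc)
  also have "\<dots> = Q"
    using Q by (simp add: PM)
  finally show ?thesis .
qed

lemma continuous_on_matrix_mult:
  fixes f :: "'a::topological_space \<Rightarrow> real^'n^'m" and g :: "'a \<Rightarrow> real^'k^'n"
  assumes "continuous_on X f" "continuous_on X g"
  shows "continuous_on X (\<lambda>x. f x ** g x)"
  unfolding matrix_matrix_mult_def by (intro continuous_intros assms)

lemma continuous_on_transpose:
  fixes f :: "'a::topological_space \<Rightarrow> real^'n^'m"
  assumes "continuous_on X f"
  shows "continuous_on X (\<lambda>x. transpose (f x))"
  unfolding transpose_def by (intro continuous_intros assms)

text \<open>\<open>P\<close> comes first in the pair because it is the component that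
  \<open>closed_compact_projection\<close> projects away.\<close>

lemma closed_moore_penrose: "closed {(P :: real^'r^'c, M :: real^'c^'r). moore_penrose M P}"
  unfolding moore_penrose_def case_prod_beta
  by (intro closed_Collect_conj closed_Collect_eq continuous_on_matrix_mult
      continuous_on_transpose continuous_intros)

text \<open>
  The graph of the pseudo-inverse is closed, so the preimage of a closed set is a countable union
  of projections of closed sets along compact balls.  The default value of \<open>pinv\<close> at matrices without
  a pseudo-inverse is kept, which makes an existence proof unnecessary.
\<close>

lemma pinv_measurable [measurable]: "(pinv :: real^'c^'r \<Rightarrow> real^'r^'c) \<in> borel_measurable borel"
proof -
  define D where "D F = {M :: real^'c^'r. \<exists>P\<in>F. moore_penrose M P}" for F
  have D: "D F \<in> sets borel" if "closed F" for F
  proof -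
    have "D F = (\<Union>n::nat. {M. \<exists>P. P \<in> F \<inter> cball 0 (real n)
        \<and> (P, M) \<in> {(P, M). moore_penrose M P}})"
      by (auto simp: D_def) (meson real_arch_simple)
    moreover have "closed {M. \<exists>P. P \<in> F \<inter> cball 0 (real n)
        \<and> (P, M) \<in> {(P, M). moore_penrose M P}}" for n
      using that by (intro closed_compact_projection closed_moore_penrose closed_Int_compact) auto
    ultimately show ?thesis
      by auto
  qed
  \<comment> \<open>\<open>c\<close> is what \<open>pinv M\<close> unfolds to when no
    \<open>P\<close> satisfies the Penrose equations, that is, for \<open>M\<close> outside
    \<open>D UNIV\<close>.\<close>
  define c where "c = (THE P :: real^'r^'c. False)"
  have "pinv -` F = D F \<union> (if c \<in> F then - D UNIV else {})" for F
  proof (rule set_eqI)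
    fix M :: "real^'c^'r"
    show "M \<in> pinv -` F \<longleftrightarrow> M \<in> D F \<union> (if c \<in> F then - D UNIV else {})"
    proof (cases "M \<in> D UNIV")
      case True
      then obtain P where P: "moore_penrose M P"
        by (auto simp: D_def)
      then have "moore_penrose M Q \<longleftrightarrow> Q = P" for Q
        using moore_penrose_unique by blast
      then show ?thesis
        by (auto simp: D_def pinv_def)
    next
      case False
      then have "\<not> moore_penrose M P" for P
        by (auto simp: D_def)
      then show ?thesis
        by (simp add: D_def pinv_def c_def)
    qed
  qed
  then have closed: "pinv -` F \<in> sets borel" if "closed F" for F :: "(real^'r^'c) set"
    using that by (auto simp: D intro!: sets.Un borel_comp)
  show ?thesis
  proof (rule borel_measurableI)
    fix F :: "(real^'r^'c) set" assume "open F"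
    then have "- (pinv -` (- F)) \<in> sets borel"
      by (intro borel_comp closed) (simp add: closed_Compl)
    then show "pinv -` F \<inter> space borel \<in> sets borel"
      by (simp add: vimage_Compl)
  qed
qed

section \<open>Measurability of matrix operations and of the iterates\<close>

lemma borel_measurable_vec_nth [measurable (raw)]:
  fixes f :: "'a \<Rightarrow> 'b::topological_space^'n"
  assumes "f \<in> borel_measurable M"
  shows "(\<lambda>x. f x $ i) \<in> borel_measurable M"
  by (rule measurable_compose[OF assms], rule borel_measurable_continuous_onI)
    (intro continuous_intros)

text \<open>A vector is the finite sum of its components placed on the axes, and each placement is
  continuous.\<close>

lemma borel_measurable_vec_lambda:
  fixes f :: "'a \<Rightarrow> 'n::finite \<Rightarrow> 'b::euclidean_space"
  assumes "\<And>i. (\<lambda>x. f x i) \<in> borel_measurable M"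
  shows "(\<lambda>x. \<chi> i. f x i) \<in> borel_measurable M"
proof -
  have "(\<lambda>x. \<Sum>i\<in>UNIV. axis i (f x i)) \<in> borel_measurable M"
  proof (intro borel_measurable_sum)
    fix i
    have "(axis i :: 'b \<Rightarrow> 'b^'n) \<in> borel_measurable (borel :: 'b measure)"
      unfolding axis_def
    proof (intro borel_measurable_continuous_onI continuous_on_vec_lambda)
      show "continuous_on UNIV (\<lambda>x :: 'b. if j = i then x else 0)" for j :: 'n
        by (cases "j = i") simp_all
    qed
    then show "(\<lambda>x. axis i (f x i)) \<in> borel_measurable M"
      by (rule measurable_compose[OF assms])
  qed
  also have "(\<lambda>x. \<Sum>i\<in>UNIV. axis i (f x i)) = (\<lambda>x. \<chi> i. f x i)"
    by (simp add: fun_eq_iff vec_eq_iff axis_def sum.delta)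
  finally show ?thesis .
qed

lemma borel_measurable_matrix_mult [measurable (raw)]:
  fixes f :: "'a \<Rightarrow> real^'n^'m" and g :: "'a \<Rightarrow> real^'k^'n"
  assumes [measurable]: "f \<in> borel_measurable M" "g \<in> borel_measurable M"
  shows "(\<lambda>x. f x ** g x) \<in> borel_measurable M"
  unfolding matrix_matrix_mult_def by (intro borel_measurable_vec_lambda) measurable

lemma borel_measurable_matrix_vector_mult [measurable (raw)]:
  fixes f :: "'a \<Rightarrow> real^'n^'m" and g :: "'a \<Rightarrow> real^'n"
  assumes [measurable]: "f \<in> borel_measurable M" "g \<in> borel_measurable M"
  shows "(\<lambda>x. f x *v g x) \<in> borel_measurable M"
  unfolding matrix_vector_mult_def by (intro borel_measurable_vec_lambda) measurable

lemma sketched_measurable [measurable]: "(\<lambda>S. sketched m S B) \<in> borel_measurable (sketch_space m)"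
proof -
  have [measurable]: "(\<lambda>S. S r) \<in> borel_measurable (sketch_space m)" if "r \<in> {..<m}" for r
    using that unfolding sketch_space_def by (rule measurable_component_singleton)
  have [measurable]: "sketch_gram m \<in> borel_measurable (sketch_space m)"
    unfolding sketch_gram_def[abs_def]
    by (intro borel_measurable_vec_lambda borel_measurable_sum borel_measurable_times) measurable
  show ?thesis
    unfolding sketched_def by measurable
qed

lemma precond_grad_measurable:
  assumes [measurable]: "S \<in> measurable N (sketch_space m)" "x \<in> borel_measurable N"
  shows "(\<lambda>\<omega>. precond_grad A b m (S \<omega>) (x \<omega>)) \<in> borel_measurable N"
  unfolding precond_grad_def grad_quad by measurable

text \<open>The ranges \<open>s < t\<close> and \<open>s \<le> t\<close> matter: \<open>x_t\<close>
  depends on past sketches only, while \<open>p_t\<close> also involves \<open>S_t\<close>.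
  \<open>N\<close> is arbitrary so that it can be the history before \<open>t\<close> as well as the
  whole probability space.\<close>

lemma
  assumes x0 [measurable]: "x0 \<in> borel_measurable N"
  shows fcg_x_measurable: "(\<And>s. s < t \<Longrightarrow> S s \<in> measurable N (sketch_space m)) \<Longrightarrow>
      (\<lambda>\<omega>. fcg_x A b m k (\<lambda>s. S s \<omega>) (x0 \<omega>) t) \<in> borel_measurable N"
    and fcg_p_measurable: "(\<And>s. s \<le> t \<Longrightarrow> S s \<in> measurable N (sketch_space m)) \<Longrightarrow>
      (\<lambda>\<omega>. fcg_p A b m k (\<lambda>s. S s \<omega>) (x0 \<omega>) t) \<in> borel_measurable N"
proof (induction t rule: less_induct)
  case (less t)
  \<comment> \<open>Shown before the two goals because the direction at \<open>t\<close> uses the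
    iterate at the same \<open>t\<close>.\<close>
  have x: "(\<lambda>\<omega>. fcg_x A b m k (\<lambda>s. S s \<omega>) (x0 \<omega>) t) \<in> borel_measurable N"
    if "\<And>s. s < t \<Longrightarrow> S s \<in> measurable N (sketch_space m)"
  proof (cases t)
    case (Suc t')
    have [measurable]: "(\<lambda>\<omega>. fcg_x A b m k (\<lambda>s. S s \<omega>) (x0 \<omega>) t') \<in> borel_measurable N"
      "(\<lambda>\<omega>. fcg_p A b m k (\<lambda>s. S s \<omega>) (x0 \<omega>) t') \<in> borel_measurable N"
      using less.IH[of t'] that by (simp_all add: Suc)
    show ?thesis
      unfolding Suc fcg_x.simps Let_def grad_quad by measurable
  qed simp
  {
    case 1
    then show ?case by (rule x)
  next
    case 2
    have [measurable]: "(\<lambda>\<omega>. fcg_p A b m k (\<lambda>s. S s \<omega>) (x0 \<omega>) j) \<in> borel_measurable N"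
      if "j \<in> {t - k t..<t}" for j
      using less.IH(2)[of j] 2 that by simp
    have [measurable]: "(\<lambda>\<omega>. precond_grad A b m (S t \<omega>)
        (fcg_x A b m k (\<lambda>s. S s \<omega>) (x0 \<omega>) t)) \<in> borel_measurable N"
      by (intro precond_grad_measurable x 2) auto
    show ?case
      unfolding fcg_p.simps[of _ _ _ _ _ _ t] Let_def by measurable
  }
qed

subsection \<open>Independence and expected quadratic forms\<close>

context prob_space
begin

text \<open>Adjoins the information \<open>E\<close> of the initial point, at index
  \<open>None\<close>, to an independent family. A finite nonempty intersection of sets from the
  family stays in \<open>G\<close>, so independence of \<open>E\<close> and \<open>G\<close> splits
  off the factor for \<open>None\<close>.\<close>

lemma indep_sets_case_option:
  assumes F: "indep_sets F I" and EG: "indep_set E G" and G: "Int_stable G"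
    and FG: "\<And>i. i \<in> I \<Longrightarrow> F i \<subseteq> G"
  shows "indep_sets (case_option E F) (insert None (Some ` I))"
proof (rule indep_setsI)
  fix i assume "i \<in> insert None (Some ` I)"
  then consider "i = None" | j where "i = Some j" "j \<in> I"
    by blast
  then show "case_option E F i \<subseteq> events"
  proof cases
    case 2
    with F show ?thesis
      by (simp add: indep_sets_def)
  qed (use indep_setD_ev1[OF EG] in simp)
next
  fix A J
  assume J: "J \<noteq> {}" "J \<subseteq> insert None (Some ` I)" "finite J"
    and A: "\<forall>j\<in>J. A j \<in> case_option E F j"
  define K where "K = Some -` J"
  have K: "finite K" "K \<subseteq> I"
    using J by (auto simp: K_def intro: finite_vimageI)
  have J_Some: "J - {None} = Some ` K"
  proof (rule set_eqI)
    show "j \<in> J - {None} \<longleftrightarrow> j \<in> Some ` K" for j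
      by (cases j) (auto simp: K_def)
  qed
  have AK: "\<forall>i\<in>K. A (Some i) \<in> F i"
    using A by (auto simp: K_def)
  have AG: "A (Some i) \<in> G" if "i \<in> K" for i
    using AK FG K that by blast
  have prob_K: "prob (\<Inter>i\<in>K. A (Some i)) = (\<Prod>i\<in>K. prob (A (Some i)))" if "K \<noteq> {}"
    using indep_setsD[OF F K(2) that K(1) AK] .
  show "prob (\<Inter>j\<in>J. A j) = (\<Prod>j\<in>J. prob (A j))"
  proof (cases "None \<in> J")
    case False
    with J_Some False have "J = Some ` K"
      by simp
    then show ?thesis
      using prob_K J by (simp add: prod.reindex)
  next
    case True
    with J_Some True have J_eq: "J = insert None (Some ` K)"
      by blast
    show ?thesis
    proof (cases "K = {}")
      case False
      have "(\<Inter>i\<in>L. A (Some i)) \<in> G" if "finite L" "L \<noteq> {}" "L \<subseteq> K" for L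
        using that
      proof (induction L rule: finite_ne_induct)
        case (insert i L)
        then show ?case
          using AG by (simp add: Int_stableD[OF G])
      qed (simp add: AG)
      then have "(\<Inter>i\<in>K. A (Some i)) \<in> G"
        using False K by blast
      moreover have "A None \<in> E"
        using A True by auto
      ultimately have "prob (A None \<inter> (\<Inter>i\<in>K. A (Some i)))
          = prob (A None) * (\<Prod>i\<in>K. prob (A (Some i)))"
        by (simp only: indep_setD[OF EG] prob_K[OF False])
      then show ?thesis
        using K by (simp add: J_eq prod.reindex)
    qed (simp add: J_eq)
  qed
qed

text \<open>\<open>N\<close> is generated by \<open>x0\<close> and the \<open>S s\<close> with
  \<open>s < t\<close>. As \<open>x0\<close> is independent of the whole sequence, \<open>x0\<close>
  and all the \<open>S s\<close> are jointly independent, and grouping them into disjoint blocks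
  preserves independence.\<close>

lemma indep_history:
  fixes S :: "nat \<Rightarrow> 'a \<Rightarrow> 'b"
  assumes S: "indep_vars (\<lambda>_. MY) S UNIV"
    and x0: "indep_rv M MX x0 (PiM UNIV (\<lambda>_. MY)) (\<lambda>\<omega> t. S t \<omega>)"
  obtains N where "space N = space M" "x0 \<in> measurable N MX"
    "\<forall>s<t. S s \<in> measurable N MY"
    "indep_set (sets N) {S t -` A \<inter> space M | A. A \<in> sets MY}"
proof -
  define F where "F s = {S s -` A \<inter> space M | A. A \<in> sets MY}" for s
  define E where "E = sets (vimage_algebra (space M) x0 MX)"
  define G where "G = sets (vimage_algebra (space M) (\<lambda>\<omega> t. S t \<omega>) (PiM UNIV (\<lambda>_. MY)))"
  have x0_meas: "x0 \<in> measurable M MX" and EG: "indep_set E G"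
    and S_prod: "(\<lambda>\<omega> t. S t \<omega>) \<in> measurable M (PiM UNIV (\<lambda>_. MY))"
    using x0 by (simp_all add: indep_rv_def E_def G_def)
  have S_meas: "S s \<in> measurable M MY" for s
    using S by (simp add: indep_vars_def2)
  have F_indep: "indep_sets F UNIV"
    using S by (simp add: indep_vars_def2 F_def[abs_def])
  have FG: "F s \<subseteq> G" for s
  proof
    fix B assume "B \<in> F s"
    then obtain A where A: "A \<in> sets MY" "B = S s -` A \<inter> space M"
      by (auto simp: F_def)
    let ?V = "vimage_algebra (space M) (\<lambda>\<omega> t. S t \<omega>) (PiM UNIV (\<lambda>_. MY))"
    have "(\<lambda>\<omega> t. S t \<omega>) \<in> measurable ?V (PiM UNIV (\<lambda>_. MY))"
      using measurable_space[OF S_prod] by (intro measurable_vimage_algebra1) auto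
    from measurable_compose[OF this measurable_component_singleton[of s]]
    have "S s \<in> measurable ?V MY"
      by simp
    from measurable_sets[OF this A(1)] show "B \<in> G"
      by (simp add: A(2) G_def)
  qed
  let ?E = "case_option E F"
  \<comment> \<open>Block \<open>True\<close> is the past, with \<open>None\<close> standing for
    \<open>x0\<close>; block \<open>False\<close> is the single index of \<open>S t\<close>.\<close>
  let ?I = "case_bool (insert None (Some ` {..<t})) {Some t}"
  have "indep_sets ?E (insert None (Some ` UNIV))"
    using FG by (intro indep_sets_case_option[OF F_indep EG]) (auto simp: G_def sets.Int_stable)
  then have "indep_sets ?E (\<Union>j\<in>UNIV. ?I j)"
    by (rule indep_sets_mono_index[rotated]) (auto simp: UNIV_bool)
  moreover have E_stable: "Int_stable (?E i)" for i
  proof (cases i)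
    case (Some s)
    have "F s = sets (vimage_algebra (space M) (S s) MY)"
      using measurable_space[OF S_meas[of s]] by (simp add: F_def sets_vimage_algebra2)
    then show ?thesis
      by (simp add: Some sets.Int_stable)
  qed (simp add: E_def sets.Int_stable)
  moreover have "disjoint_family_on ?I UNIV"
    by (auto simp: disjoint_family_on_def split: bool.split)
  ultimately have indep:
    "indep_sets (\<lambda>j. sigma_sets (space M) (\<Union>i\<in>?I j. ?E i)) UNIV"
    by (rule indep_sets_collect_sigma)
  define N where "N = sigma (space M) (\<Union>i\<in>?I True. ?E i)"
  have sub: "(\<Union>i\<in>?I True. ?E i) \<subseteq> Pow (space M)"
    using sets.space_closed[of "vimage_algebra (space M) x0 MX"] by (auto simp: E_def F_def)
  have sets_N: "sets N = sigma_sets (space M) (\<Union>i\<in>?I True. ?E i)"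
    using sub by (simp add: N_def)
  have space_N: "space N = space M"
    using sub by (simp add: N_def)
  have in_N: "?E i \<subseteq> sets N" if "i \<in> ?I True" for i
    using that unfolding sets_N by (intro subsetI sigma_sets.Basic) blast
  show thesis
  proof (rule that[OF space_N])
    show "x0 \<in> measurable N MX"
    proof (rule measurableI)
      show "x0 -` A \<inter> space N \<in> sets N" if "A \<in> sets MX" for A
        using in_N[of None] in_vimage_algebra[OF that, of x0 "space M"]
        by (auto simp: E_def space_N)
    qed (use measurable_space[OF x0_meas] space_N in auto)
    show "\<forall>s<t. S s \<in> measurable N MY"
    proof (intro allI impI measurableI)
      fix s assume "s < t"
      show "S s -` A \<inter> space N \<in> sets N" if "A \<in> sets MY" for A
        using in_N[of "Some s"] \<open>s < t\<close> that by (auto simp: F_def space_N)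
    qed (use measurable_space[OF S_meas] space_N in auto)
    show "indep_set (sets N) {S t -` A \<inter> space M | A. A \<in> sets MY}"
      unfolding indep_set_def
      using indep
    proof (rule indep_sets_mono_sets)
      fix j :: bool
      show "case_bool (sets N) {S t -` A \<inter> space M | A. A \<in> sets MY} j
        \<subseteq> sigma_sets (space M) (\<Union>i\<in>?I j. ?E i)"
        by (cases j) (auto simp: sets_N F_def intro!: sigma_sets.Basic)
    qed
  qed
qed

text \<open>Passes from sigma-algebras to random variables: preimages under \<open>f\<close> lie in
  \<open>N\<close>, and preimages under the composite with \<open>g\<close> are preimages under
  \<open>Y\<close>.\<close>

lemma indep_var_history:
  assumes indep: "indep_set (sets N) {Y -` A \<inter> space M | A. A \<in> sets MY}"
    and Y: "Y \<in> measurable M MY" and N: "space N = space M"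
    and f: "f \<in> borel_measurable N" and g: "g \<in> borel_measurable MY"
  shows "indep_var borel f borel (\<lambda>\<omega>. g (Y \<omega>))"
proof -
  have sub: "sets N \<subseteq> events"
    using indep by (rule indep_setD_ev1)
  have fM: "random_variable borel f"
    using f by (rule measurable_mono[THEN subsetD, rotated -1]) (auto simp: N sub)
  have gM: "random_variable borel (\<lambda>\<omega>. g (Y \<omega>))"
    using Y g by (rule measurable_compose)
  have sigma: "sigma_sets (space M) {h -` A \<inter> space M | A. A \<in> sets borel}
      = {h -` A \<inter> space M | A. A \<in> sets borel}" for h :: "'a \<Rightarrow> 'c::topological_space"
    using sets_vimage_algebra2[of h "space M" borel] by (simp add: sets_vimage_algebra)
  have "{f -` A \<inter> space M | A. A \<in> sets borel} \<subseteq> sets N"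
    using measurable_sets[OF f] by (auto simp: N)
  moreover have "{(\<lambda>\<omega>. g (Y \<omega>)) -` A \<inter> space M | A. A \<in> sets borel}
      \<subseteq> {Y -` A \<inter> space M | A. A \<in> sets MY}"
  proof clarify
    fix A :: "'c set" assume "A \<in> sets borel"
    from measurable_sets[OF g this] have "g -` A \<inter> space MY \<in> sets MY" .
    moreover have "(\<lambda>\<omega>. g (Y \<omega>)) -` A \<inter> space M = Y -` (g -` A \<inter> space MY) \<inter> space M"
      using measurable_space[OF Y] by auto
    ultimately show "\<exists>B. (\<lambda>\<omega>. g (Y \<omega>)) -` A \<inter> space M = Y -` B \<inter> space M \<and> B \<in> sets MY"
      by blast
  qed
  ultimately show ?thesis
    using indep fM gM unfolding indep_var_eq sigma indep_sets2_eq
    by (meson order_trans subsetD)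
qed

text \<open>Expand the form into the products \<open>w_i w_j J_ij\<close>. Independence factors each
  expectation, the off-diagonal entries of \<open>J\<close> have mean 0, and the diagonal terms add
  up to the squared norm. Independence is stated entrywise because \<open>indep_var\<close> wants a
  common value type.\<close>

lemma has_bochner_integral_quadratic_form:
  fixes w :: "'a \<Rightarrow> real^'d" and J :: "'a \<Rightarrow> real^'d^'d"
  assumes indep: "\<And>i j. indep_var borel (\<lambda>\<omega>. w \<omega> $ i * w \<omega> $ j) borel (\<lambda>\<omega>. J \<omega> $ i $ j)"
    and [measurable]: "w \<in> borel_measurable M"
    and w: "integrable M (\<lambda>\<omega>. (norm (w \<omega>))\<^sup>2)"
    and J: "has_bochner_integral M J (\<theta> *\<^sub>R mat 1)"
  shows "has_bochner_integral M (\<lambda>\<omega>. inner (w \<omega>) (J \<omega> *v w \<omega>))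
    (\<theta> * expectation (\<lambda>\<omega>. (norm (w \<omega>))\<^sup>2))"
proof -
  have ww: "integrable M (\<lambda>\<omega>. w \<omega> $ i * w \<omega> $ j)" for i j
  proof (rule Bochner_Integration.integrable_bound[OF w])
    have "\<bar>w \<omega> $ i * w \<omega> $ j\<bar> \<le> (norm (w \<omega>))\<^sup>2" for \<omega>
      unfolding abs_mult power2_eq_square
      by (intro mult_mono component_le_norm_cart) auto
    then show "AE \<omega> in M. norm (w \<omega> $ i * w \<omega> $ j) \<le> norm ((norm (w \<omega>))\<^sup>2)"
      by simp
  qed measurable
  have Jij: "has_bochner_integral M (\<lambda>\<omega>. J \<omega> $ i $ j) (if i = j then \<theta> else 0)" for i j
  proof -
    have "bounded_linear (\<lambda>J :: real^'d^'d. J $ i $ j)"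
      by (intro bounded_linear_compose[OF bounded_linear_vec_nth] bounded_linear_vec_nth)
    from has_bochner_integral_bounded_linear[OF this J] show ?thesis
      by (cases "i = j") (simp_all add: mat_def)
  qed
  have "has_bochner_integral M (\<lambda>\<omega>. w \<omega> $ i * w \<omega> $ j * J \<omega> $ i $ j)
      (expectation (\<lambda>\<omega>. w \<omega> $ i * w \<omega> $ j) * (if i = j then \<theta> else 0))" for i j
    using indep_var_integrable[OF indep ww] indep_var_lebesgue_integral[OF indep ww] Jij[of i j]
    by (auto simp: has_bochner_integral_iff)
  then have "has_bochner_integral M (\<lambda>\<omega>. \<Sum>i\<in>UNIV. \<Sum>j\<in>UNIV. w \<omega> $ i * w \<omega> $ j * J \<omega> $ i $ j)
      (\<Sum>i\<in>UNIV. \<Sum>j\<in>UNIV. expectation (\<lambda>\<omega>. w \<omega> $ i * w \<omega> $ j) * (if i = j then \<theta> else 0))"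
    by (intro has_bochner_integral_sum)
  also have "(\<lambda>\<omega>. \<Sum>i\<in>UNIV. \<Sum>j\<in>UNIV. w \<omega> $ i * w \<omega> $ j * J \<omega> $ i $ j)
      = (\<lambda>\<omega>. inner (w \<omega>) (J \<omega> *v w \<omega>))"
    by (simp add: inner_vec_def matrix_vector_mult_def sum_distrib_left mult_ac)
  also have "(\<Sum>i\<in>UNIV. \<Sum>j\<in>UNIV. expectation (\<lambda>\<omega>. w \<omega> $ i * w \<omega> $ j) * (if i = j then \<theta> else 0))
      = \<theta> * expectation (\<lambda>\<omega>. \<Sum>i\<in>UNIV. w \<omega> $ i * w \<omega> $ i)"
    by (simp add: if_distrib cong: if_cong) (simp add: ww sum_distrib_left mult.commute)
  also have "(\<lambda>\<omega>. \<Sum>i\<in>UNIV. w \<omega> $ i * w \<omega> $ i) = (\<lambda>\<omega>. (norm (w \<omega>))\<^sup>2)"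
    by (simp add: power2_norm_eq_inner inner_vec_def)
  finally show ?thesis .
qed

end

subsection \<open>The convergence rate\<close>

theorem corollary4p2:
  fixes M :: "'w measure"
    and A :: "real^'d^'n" and b :: "real^'d"
    and D :: "nat \<Rightarrow> 'n sketch measure"
    and S :: "nat \<Rightarrow> 'w \<Rightarrow> 'n sketch"
    and x0 :: "'w \<Rightarrow> real^'d"
    and m m0 :: nat and \<theta>1 \<theta>2 :: real and k :: "nat \<Rightarrow> nat"
  assumes "CARD('n) \<ge> CARD('d)"
    and "rank A = CARD('d)"
    and "prob_space M"
    and "embedding_family D"
    and "inverse_unbiased_moments TYPE('d) D m0"
    and "m \<ge> m0"
    and "\<theta>1 > 0" and "\<theta>2 > 0"
    and "inverse_moments TYPE('d) m (D m) \<theta>1 \<theta>2"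
    and "prob_space.indep_vars M (\<lambda>_. sketch_space m) S UNIV"
    and "\<And>t. distr M (sketch_space m) (S t) = D m"
    and "\<And>t. AE \<omega> in M. full_column_rank_sketch m (S t \<omega>) A"
    and "indep_rv M borel x0
           (PiM UNIV (\<lambda>_. sketch_space m)) (\<lambda>\<omega> t. S t \<omega>)"
    and "integrable M (\<lambda>\<omega>. fcg_err A b m k (\<lambda>s. S s \<omega>) (x0 \<omega>) 0)"
    and "0 < integral\<^sup>L M (\<lambda>\<omega>. fcg_err A b m k (\<lambda>s. S s \<omega>) (x0 \<omega>) 0)"
    and "\<And>t. 0 < k (Suc t) \<and> k (Suc t) \<le> k t + 1"
    and "\<And>t. k t \<le> t"
  shows "\<forall>t. integrable M (\<lambda>\<omega>. fcg_err A b m k (\<lambda>s. S s \<omega>) (x0 \<omega>) t) \<and>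
           integral\<^sup>L M (\<lambda>\<omega>. fcg_err A b m k (\<lambda>s. S s \<omega>) (x0 \<omega>) t) /
             integral\<^sup>L M (\<lambda>\<omega>. fcg_err A b m k (\<lambda>s. S s \<omega>) (x0 \<omega>) 0)
           \<le> (1 - \<theta>1\<^sup>2 / \<theta>2) ^ t"
proof -
  interpret prob_space M by fact
  note A = assms(2) and S_indep = assms(10) and S_distr = assms(11) and x0_indep = assms(13)
  have k: "k (Suc t) \<le> k t + 1" for t
    using assms(16) by blast
  have S [measurable]: "S t \<in> measurable M (sketch_space m)" for t
    using S_indep by (simp add: indep_vars_def2)
  have x0 [measurable]: "x0 \<in> borel_measurable M"
    using x0_indep by (simp add: indep_rv_def)
  define x where "x t \<omega> = fcg_x A b m k (\<lambda>s. S s \<omega>) (x0 \<omega>) t" for t \<omega>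
  define \<delta> where "\<delta> t \<omega> = fcg_err A b m k (\<lambda>s. S s \<omega>) (x0 \<omega>) t" for t \<omega>
  have \<delta>_eq: "\<delta> t \<omega> = subopt A b (x t \<omega>)" for t \<omega>
    by (simp add: \<delta>_def x_def fcg_err_def)
  have \<delta>_nonneg: "0 \<le> \<delta> t \<omega>" for t \<omega>
    by (simp add: \<delta>_eq subopt_eq_norm)
  have [measurable]: "x t \<in> borel_measurable M" for t
    unfolding x_def[abs_def] by (rule fcg_x_measurable) measurable
  have \<delta>_meas [measurable]: "\<delta> t \<in> borel_measurable M" for t
    unfolding \<delta>_eq[abs_def] subopt_eq_norm by measurable
  obtain U :: "real^'d^'n" and R :: "real^'d^'d"
    where U: "transpose U ** U = mat 1" and AUR: "A = U ** R" and R: "invertible R"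
    using orthonormal_factorization[OF A] .
  define w where "w t \<omega> = R *v (x t \<omega> - xstar A b)" for t \<omega>
  define J where "J T = matrix_inv (sketched m T U)" for T
  have [measurable]: "w t \<in> borel_measurable M" for t
    unfolding w_def[abs_def] by measurable
  have w_norm: "(norm (w t \<omega>))\<^sup>2 = 2 * \<delta> t \<omega>" for t \<omega>
    by (simp add: \<delta>_eq subopt_eq_norm AUR w_def power2_norm_eq_inner
        inner_orthonormal[OF U] matrix_vector_mul_assoc[symmetric])
  have mom: "AE T in D m. invertible (sketched m T U)"
    "has_bochner_integral (D m) J (\<theta>1 *\<^sub>R mat 1)"
    "has_bochner_integral (D m) (\<lambda>T. J T ** J T) (\<theta>2 *\<^sub>R mat 1)"
    using assms(9) U by (simp_all add: inverse_moments_def J_def[abs_def])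
  have C_inv: "AE \<omega> in M. invertible (sketched m (S t \<omega>) U)" for t
    using mom(1) S unfolding S_distr[of t, symmetric] by (rule AE_distrD[rotated])
  define c where "c = \<theta>1 / \<theta>2"
  \<comment> \<open>Stated for general \<open>F\<close> to serve both \<open>J\<close> with
    \<theta>1 and its square with \<theta>2. The factor 2 comes from \<open>w_norm\<close>.\<close>
  have quadratic: "has_bochner_integral M (\<lambda>\<omega>. inner (w t \<omega>) (F (S t \<omega>) *v w t \<omega>))
      (2 * \<theta> * expectation (\<delta> t))"
    if F: "has_bochner_integral (D m) F (\<theta> *\<^sub>R mat 1)" and int: "integrable M (\<delta> t)"
    for F \<theta> t
  proof -
    have "has_bochner_integral (distr M (sketch_space m) (S t)) F (\<theta> *\<^sub>R mat 1)"
      using F by (simp add: S_distr)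
    then have F_distr: "integrable (distr M (sketch_space m) (S t)) F"
        "integral\<^sup>L (distr M (sketch_space m) (S t)) F = \<theta> *\<^sub>R mat 1"
      by (simp_all only: has_bochner_integral_iff)
    then have F_meas [measurable]: "F \<in> borel_measurable (sketch_space m)"
      using borel_measurable_integrable[OF F_distr(1)] by simp
    have F_int: "has_bochner_integral M (\<lambda>\<omega>. F (S t \<omega>)) (\<theta> *\<^sub>R mat 1)"
      using F_distr integrable_distr[OF S F_distr(1)] integral_distr[OF S F_meas]
      by (simp add: has_bochner_integral_iff)
    obtain N where N: "space N = space M" and x0_N: "x0 \<in> borel_measurable N"
      and S_N: "\<forall>s<t. S s \<in> measurable N (sketch_space m)"
      and indep: "indep_set (sets N) {S t -` A \<inter> space M | A. A \<in> sets (sketch_space m)}"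
      using indep_history[OF S_indep x0_indep] by blast
    \<comment> \<open>The iterate at \<open>t\<close> uses only sketches before \<open>t\<close>, so
      it is measurable for the history \<open>N\<close>; hence functions of \<open>w t\<close> are
      independent of \<open>S t\<close>.\<close>
    have [measurable]: "x t \<in> borel_measurable N"
      unfolding x_def[abs_def] by (intro fcg_x_measurable x0_N) (use S_N in blast)
    have [measurable]: "w t \<in> borel_measurable N"
      unfolding w_def[abs_def] by measurable
    have "has_bochner_integral M (\<lambda>\<omega>. inner (w t \<omega>) (F (S t \<omega>) *v w t \<omega>))
        (\<theta> * expectation (\<lambda>\<omega>. (norm (w t \<omega>))\<^sup>2))"
    proof (rule has_bochner_integral_quadratic_form[OF _ _ _ F_int])
      fix i j
      show "indep_var borel (\<lambda>\<omega>. w t \<omega> $ i * w t \<omega> $ j) borel (\<lambda>\<omega>. F (S t \<omega>) $ i $ j)"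
        by (rule indep_var_history[OF indep S N, of _ "\<lambda>T. F T $ i $ j"]) measurable
    qed (simp_all add: w_norm int)
    then show ?thesis
      by (simp add: w_norm mult_ac)
  qed
  have step: "integrable M (\<delta> (Suc t)) \<and>
      expectation (\<delta> (Suc t)) \<le> (1 - \<theta>1\<^sup>2 / \<theta>2) * expectation (\<delta> t)"
    if int: "integrable M (\<delta> t)" for t
  proof
    have descent: "\<delta> (Suc t) \<omega> \<le> subopt A b (x t \<omega> + a *\<^sub>R precond_grad A b m (S t \<omega>) (x t \<omega>))"
      for a \<omega>
      unfolding \<delta>_eq x_def by (rule fcg_subopt_descent[where k = k and S = "\<lambda>s. S s \<omega>", OF A k])
    \<comment> \<open>The choice \<open>a = 0\<close> gives monotone decrease, which provides an
      integrable bound before any expectation is compared.\<close>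
    have "\<delta> (Suc t) \<omega> \<le> \<delta> t \<omega>" for \<omega>
      using descent[of \<omega> 0] by (simp add: \<delta>_eq)
    then show int': "integrable M (\<delta> (Suc t))"
      using \<delta>_nonneg by (intro Bochner_Integration.integrable_bound[OF int]) auto
    \<comment> \<open>The sign is \<open>- c\<close> because the descent lemmas add a multiple of
      the preconditioned gradient, while the step goes against it.\<close>
    let ?b = "\<lambda>\<omega>. (2 * \<delta> t \<omega> + 2 * (- c) * inner (w t \<omega>) (J (S t \<omega>) *v w t \<omega>)
        + (- c)\<^sup>2 * inner (w t \<omega>) ((J (S t \<omega>) ** J (S t \<omega>)) *v w t \<omega>)) / 2"
    have "has_bochner_integral M ?b
        ((2 * expectation (\<delta> t) + 2 * (- c) * (2 * \<theta>1 * expectation (\<delta> t))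
          + (- c)\<^sup>2 * (2 * \<theta>2 * expectation (\<delta> t))) / 2)"
      by (intro has_bochner_integral_divide_zero has_bochner_integral_add
          has_bochner_integral_mult_right has_bochner_integral_integrable int
          quadratic[OF mom(2) int] quadratic[OF mom(3) int])
    then have b: "integrable M ?b" "expectation ?b
        = (2 * expectation (\<delta> t) + 2 * (- c) * (2 * \<theta>1 * expectation (\<delta> t))
          + (- c)\<^sup>2 * (2 * \<theta>2 * expectation (\<delta> t))) / 2"
      by (simp_all add: has_bochner_integral_iff)
    have "AE \<omega> in M. \<delta> (Suc t) \<omega> \<le> ?b \<omega>"
      using C_inv[of t]
    proof (eventually_elim)
      case (elim \<omega>)
      show ?case
        using descent[of \<omega> "- c"]
          subopt_preconditioned_step[OF A AUR U R elim, of b "x t \<omega>" "- c"]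
        by (simp add: J_def w_def[symmetric] w_norm)
    qed
    then have "expectation (\<delta> (Suc t)) \<le> expectation ?b"
      by (rule integral_mono_AE[OF int' b(1)])
    also have "\<dots> = (1 - \<theta>1\<^sup>2 / \<theta>2) * expectation (\<delta> t)"
      unfolding b(2) using \<open>\<theta>2 > 0\<close>
      by (simp add: c_def field_simps power2_eq_square)
    finally show "expectation (\<delta> (Suc t)) \<le> (1 - \<theta>1\<^sup>2 / \<theta>2) * expectation (\<delta> t)" .
  qed
  have int0: "integrable M (\<delta> 0)" and pos: "0 < expectation (\<delta> 0)"
    using assms(14,15) by (simp_all add: \<delta>_def[abs_def])
  \<comment> \<open>\<open>\<theta>1\<^sup>2 \<le> \<theta>2\<close> comes for free from the first step, because \<open>E \<delta>\<^sub>0 > 0\<close>.\<close>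
  have "0 \<le> expectation (\<delta> (Suc 0))"
    using \<delta>_nonneg by simp
  also have "\<dots> \<le> (1 - \<theta>1\<^sup>2 / \<theta>2) * expectation (\<delta> 0)"
    using step[OF int0] by simp
  finally have rate: "0 \<le> 1 - \<theta>1\<^sup>2 / \<theta>2"
    using pos by (simp add: zero_le_mult_iff)
  have "integrable M (\<delta> t) \<and> expectation (\<delta> t) \<le> (1 - \<theta>1\<^sup>2 / \<theta>2) ^ t * expectation (\<delta> 0)" for t
  proof (induction t)
    case (Suc t)
    then have "integrable M (\<delta> (Suc t))"
      and "expectation (\<delta> (Suc t)) \<le> (1 - \<theta>1\<^sup>2 / \<theta>2) * expectation (\<delta> t)"
      using step by auto
    \<comment> \<open>Multiplying the induction hypothesis by the rate keeps the inequality only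
      because the rate is nonnegative.\<close>
    moreover have "(1 - \<theta>1\<^sup>2 / \<theta>2) * expectation (\<delta> t)
        \<le> (1 - \<theta>1\<^sup>2 / \<theta>2) * ((1 - \<theta>1\<^sup>2 / \<theta>2) ^ t * expectation (\<delta> 0))"
      using Suc rate by (intro mult_left_mono) auto
    ultimately show ?case
      by (simp add: mult.assoc)
  qed (simp add: int0)
  then have "integrable M (\<delta> t) \<and> expectation (\<delta> t) / expectation (\<delta> 0) \<le> (1 - \<theta>1\<^sup>2 / \<theta>2) ^ t" for t
    using pos by (simp add: pos_divide_le_eq)
  then show ?thesis
    by (simp add: \<delta>_def[abs_def])
qed

end
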